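(* For $\lambda>0$ and $k\in\{1,2\}$, let $n\ell_{k,\lambda}$, $nw_{k,\lambda}$, $nd_{k,\lambda}$ be the probabilities that the first player loses, the first player wins, and the game is a draw, respectively, in the $k$-jump normal game started at the root of the Galton-Watson tree with Poisson$(\lambda)$ offspring distribution. Then for all $\lambda$ sufficiently large, $$n\ell_{2,\lambda}\le n\ell_{1,\lambda},\qquad nd_{2,\lambda}<nd_{1,\lambda},\qquad nw_{1,\lambda}<nw_{2,\lambda}.$$
   Context: In the Galton-Watson tree every vertex independently has a Poisson$(\lambda)$ number of children. In the $k$-jump normal game a token starts at a vertex; two players alternate, a move relocating the token from its current vertex $u$ to any descendant $v\ne u$ of $u$ at graph distance at most $k$ from $u$. A player unable to move loses. The whole tree is known to both players and both play optimally; a game that goes on forever is a draw. *)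

theory Defs
  imports "HOL-Probability.Probability" "HOL-Library.Sublist"
begin

section \<open>Two-player games given by a move relation\<close>

text \<open>
  \<open>M u v\<close> says that the token may be moved from \<open>u\<close> to \<open>v\<close>. A history is the nonempty list of
  all positions visited so far, the starting position first, so that after \<open>n\<close> moves it has
  length \<open>n + 1\<close>. Strategies may depend on the whole history.
\<close>

datatype player = First | Second

definition to_move :: "'v list \<Rightarrow> player" where
  "to_move h = (if odd (length h) then First else Second)"

definition can_move :: "('v \<Rightarrow> 'v \<Rightarrow> bool) \<Rightarrow> 'v \<Rightarrow> bool" where
  "can_move M u \<longleftrightarrow> (\<exists>v. M u v)"

definition finite_play :: "('v \<Rightarrow> 'v \<Rightarrow> bool) \<Rightarrow> 'v \<Rightarrow> 'v list \<Rightarrow> bool" where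
  "finite_play M x h \<longleftrightarrow> h \<noteq> [] \<and> hd h = x \<and> successively M h"

definition infinite_play :: "('v \<Rightarrow> 'v \<Rightarrow> bool) \<Rightarrow> 'v \<Rightarrow> (nat \<Rightarrow> 'v) \<Rightarrow> bool" where
  "infinite_play M x p \<longleftrightarrow> p 0 = x \<and> (\<forall>n. M (p n) (p (Suc n)))"

type_synonym 'v strategy = "'v list \<Rightarrow> 'v"

definition legal_strategy :: "('v \<Rightarrow> 'v \<Rightarrow> bool) \<Rightarrow> player \<Rightarrow> 'v strategy \<Rightarrow> bool" where
  "legal_strategy M P \<sigma> \<longleftrightarrow>
     (\<forall>h. h \<noteq> [] \<and> to_move h = P \<and> can_move M (last h) \<longrightarrow> M (last h) (\<sigma> h))"

definition follows :: "player \<Rightarrow> 'v strategy \<Rightarrow> 'v list \<Rightarrow> bool" where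
  "follows P \<sigma> h \<longleftrightarrow>
     (\<forall>n. 0 < n \<and> n < length h \<and> to_move (take n h) = P \<longrightarrow> h ! n = \<sigma> (take n h))"

definition follows_forever :: "player \<Rightarrow> 'v strategy \<Rightarrow> (nat \<Rightarrow> 'v) \<Rightarrow> bool" where
  "follows_forever P \<sigma> p \<longleftrightarrow> (\<forall>n. follows P \<sigma> (map p [0..<n]))"

text \<open>
  A player who is to move but cannot loses, and infinite plays are draws. So a strategy of \<open>P\<close>
  wins if it admits no infinite play and every play following it that has come to an end
  did so with the opponent of \<open>P\<close> to move.
\<close>

definition winning_strategy ::
  "('v \<Rightarrow> 'v \<Rightarrow> bool) \<Rightarrow> 'v \<Rightarrow> player \<Rightarrow> 'v strategy \<Rightarrow> bool" where
  "winning_strategy M x P \<sigma> \<longleftrightarrow>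
     legal_strategy M P \<sigma> \<and>
     (\<forall>h. finite_play M x h \<and> follows P \<sigma> h \<and> \<not> can_move M (last h) \<longrightarrow> to_move h \<noteq> P) \<and>
     (\<forall>p. infinite_play M x p \<longrightarrow> \<not> follows_forever P \<sigma> p)"

definition first_player_wins :: "('v \<Rightarrow> 'v \<Rightarrow> bool) \<Rightarrow> 'v \<Rightarrow> bool" where
  "first_player_wins M x \<longleftrightarrow> (\<exists>\<sigma>. winning_strategy M x First \<sigma>)"

definition first_player_loses :: "('v \<Rightarrow> 'v \<Rightarrow> bool) \<Rightarrow> 'v \<Rightarrow> bool" where
  "first_player_loses M x \<longleftrightarrow> (\<exists>\<sigma>. winning_strategy M x Second \<sigma>)"

definition game_drawn :: "('v \<Rightarrow> 'v \<Rightarrow> bool) \<Rightarrow> 'v \<Rightarrow> bool" where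
  "game_drawn M x \<longleftrightarrow> \<not> first_player_wins M x \<and> \<not> first_player_loses M x"

section \<open>The Galton-Watson tree and the \<open>k\<close>-jump normal game\<close>

text \<open>
  Ulam-Harris labelling: the root is \<open>[]\<close>, and the children of the vertex \<open>v\<close> are \<open>v @ [i]\<close> for
  \<open>i < \<omega> v\<close>, where \<open>\<omega>\<close> assigns a number of children to every conceivable vertex.
\<close>

type_synonym vertex = "nat list"

inductive_set tree :: "(vertex \<Rightarrow> nat) \<Rightarrow> vertex set" for \<omega> :: "vertex \<Rightarrow> nat" where
  root: "[] \<in> tree \<omega>"
| child: "v \<in> tree \<omega> \<Longrightarrow> i < \<omega> v \<Longrightarrow> v @ [i] \<in> tree \<omega>"

text \<open>
  The descendants of \<open>u\<close> are the vertices of the tree that have \<open>u\<close> as a prefix, and their graph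
  distance from \<open>u\<close> is the difference of the lengths.
\<close>

definition jump :: "nat \<Rightarrow> (vertex \<Rightarrow> nat) \<Rightarrow> vertex \<Rightarrow> vertex \<Rightarrow> bool" where
  "jump k \<omega> u v \<longleftrightarrow>
     u \<in> tree \<omega> \<and> v \<in> tree \<omega> \<and> strict_prefix u v \<and> length v - length u \<le> k"

definition GW :: "real \<Rightarrow> (vertex \<Rightarrow> nat) measure" where
  "GW lam = (\<Pi>\<^sub>M v\<in>UNIV. measure_pmf (poisson_pmf lam))"

definition nl :: "nat \<Rightarrow> real \<Rightarrow> real" where
  "nl k lam = measure (GW lam) {\<omega> \<in> space (GW lam). first_player_loses (jump k \<omega>) []}"

definition nw :: "nat \<Rightarrow> real \<Rightarrow> real" where
  "nw k lam = measure (GW lam) {\<omega> \<in> space (GW lam). first_player_wins (jump k \<omega>) []}"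

definition nd :: "nat \<Rightarrow> real \<Rightarrow> real" where
  "nd k lam = measure (GW lam) {\<omega> \<in> space (GW lam). game_drawn (jump k \<omega>) []}"

end

theory Submission
  imports Defs "HOL-Real_Asymp.Real_Asymp"
begin

text \<open>
  For large \<open>lam\<close> almost every game is a draw, and the decided ones are mostly decided by leaves
  near the root. The root itself is a leaf with probability \<open>exp (- lam)\<close>, which is the leading
  term of the losing probability for both values of \<open>k\<close>. For \<open>k = 1\<close> a win is typically due to a
  leaf among the roughly \<open>lam\<close> children, for \<open>k = 2\<close> to a leaf among the roughly \<open>lam^2\<close>
  grandchildren. So \<open>nw 2\<close> is of order \<open>lam^2 * exp (- lam)\<close>, which exceeds even the total
  probability \<open>nw 1 + nl 1\<close> of order \<open>lam * exp (- lam)\<close>; this gives the two strict inequalities.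

  The comparison of the losing probabilities is finer, as their leading terms agree. Conditioning on
  the children of the root shows \<open>nl 1 = exp (- lam * (1 - nw 1))\<close> and
  \<open>nl 2 = exp (- lam * (1 - q))\<close>, where \<open>q\<close> is the probability that a tree is won for \<open>k = 2\<close> and
  all its children are won as well. The second requirement is itself unlikely, since a typical tree
  has many children and most of them are draws; so \<open>q\<close> is at most of order
  \<open>lam^2 * exp (- 3/2 * lam)\<close>, while \<open>nw 1\<close> is at least of order \<open>lam * exp (- lam)\<close>.

  To make this rigorous, winning strategies are first replaced by finite stages of backward
  induction, which is possible since the tree is locally finite (\<open>first_player_wins_iff_won\<close>,
  \<open>first_player_loses_iff_lost\<close>). The branching property (\<open>prob_all_children\<close>) then yields equations
  between the outcome probabilities (\<open>nl_1\<close>, \<open>nw_1\<close>, \<open>two_jump_equations\<close>). These equations do not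
  determine the probabilities (for \<open>k = 1\<close> there is a spurious solution without draws), so smallness
  is first proved for the stages, one after the other (\<open>nw_le_quarter\<close>). Once \<open>nw k\<close> is known to be at most \<open>1/4\<close>, inserting the equations into each
  other gives the orders of magnitude above.
\<close>

section \<open>Backward induction for finitely branching games\<close>

text \<open>
  Stages of the backward induction that starts from the dead ends: at stage \<open>n\<close> the opponent can
  force the player who moves at \<open>u\<close> to be stuck after at most \<open>n - 1\<close> further moves of each side.
  Stage \<open>0\<close> is empty, so that stage \<open>1\<close> consists of the dead ends.
\<close>

primrec loses_within :: "('v \<Rightarrow> 'v \<Rightarrow> bool) \<Rightarrow> nat \<Rightarrow> 'v \<Rightarrow> bool" where
  "loses_within M 0 u \<longleftrightarrow> False"
| "loses_within M (Suc n) u \<longleftrightarrow> (\<forall>v. M u v \<longrightarrow> (\<exists>w. M v w \<and> loses_within M n w))"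

definition wins_within :: "('v \<Rightarrow> 'v \<Rightarrow> bool) \<Rightarrow> nat \<Rightarrow> 'v \<Rightarrow> bool" where
  "wins_within M n u \<longleftrightarrow> (\<exists>v. M u v \<and> loses_within M n v)"

definition lost :: "('v \<Rightarrow> 'v \<Rightarrow> bool) \<Rightarrow> 'v \<Rightarrow> bool" where
  "lost M u \<longleftrightarrow> (\<exists>n. loses_within M n u)"

definition won :: "('v \<Rightarrow> 'v \<Rightarrow> bool) \<Rightarrow> 'v \<Rightarrow> bool" where
  "won M u \<longleftrightarrow> (\<exists>n. wins_within M n u)"

lemma loses_within_Suc: "loses_within M (Suc n) u \<longleftrightarrow> (\<forall>v. M u v \<longrightarrow> wins_within M n v)"
  by (simp add: wins_within_def)

lemma loses_within_mono: "m \<le> n \<Longrightarrow> loses_within M m u \<Longrightarrow> loses_within M n u"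
proof (induction m arbitrary: n u)
  case (Suc m)
  then obtain n' where n': "n = Suc n'" "m \<le> n'" by (metis Suc_le_D Suc_le_mono)
  show ?case
    using Suc.prems(2) Suc.IH[OF n'(2)] unfolding n'(1) loses_within.simps by blast
qed simp

lemma wins_within_mono: "m \<le> n \<Longrightarrow> wins_within M m u \<Longrightarrow> wins_within M n u"
  unfolding wins_within_def using loses_within_mono[of m n M] by fast

lemma won_iff: "won M u \<longleftrightarrow> (\<exists>v. M u v \<and> lost M v)"
  by (auto simp: won_def lost_def wins_within_def)

text \<open>
  Finite branching is what allows stages indexed by natural numbers: the winning stages of the
  finitely many successors have a common upper bound. With infinite branching, transfinite stages
  would occur.
\<close>

lemma lost_iff:
  assumes "finite {v. M u v}"
  shows "lost M u \<longleftrightarrow> (\<forall>v. M u v \<longrightarrow> won M v)"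
proof
  assume "lost M u"
  then obtain n where "loses_within M n u" by (auto simp: lost_def)
  then show "\<forall>v. M u v \<longrightarrow> won M v"
    by (cases n) (auto simp: loses_within_Suc won_def simp del: loses_within.simps(2))
next
  assume "\<forall>v. M u v \<longrightarrow> won M v"
  then obtain n where n: "\<And>v. M u v \<Longrightarrow> wins_within M (n v) v"
    unfolding won_def by metis
  have "loses_within M (Suc (Max (n ` {v. M u v}))) u"
    unfolding loses_within_Suc
    using assms by (auto intro!: wins_within_mono[OF Max_ge n])
  then show "lost M u" unfolding lost_def by blast
qed

lemma not_won_and_lost:
  assumes "won M u" shows "\<not> lost M u"
proof -
  have "\<not> (loses_within M m u \<and> wins_within M n u)" for m n
  proof (induction n arbitrary: m u)
    case 0 then show ?case by (simp add: wins_within_def)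
  next
    case (Suc n)
    show ?case
    proof
      assume *: "loses_within M m u \<and> wins_within M (Suc n) u"
      then obtain v where v: "M u v" "loses_within M (Suc n) v" by (auto simp: wins_within_def)
      from * obtain m' where "m = Suc m'" by (cases m) auto
      with * v obtain w where w: "M v w" "loses_within M m' w" by auto
      with v have "wins_within M n w" by (auto simp: loses_within_Suc simp del: loses_within.simps(2))
      with w Suc show False by blast
    qed
  qed
  with assms show ?thesis by (auto simp: won_def lost_def)
qed

text \<open>
  The invariant behind both directions of the comparison with strategies: a player who follows a
  winning strategy never leaves these histories, and a player without one can be kept out of them.
\<close>

definition winning_for :: "('v \<Rightarrow> 'v \<Rightarrow> bool) \<Rightarrow> player \<Rightarrow> 'v list \<Rightarrow> bool" where
  "winning_for M P h \<longleftrightarrow> (if to_move h = P then won M (last h) else lost M (last h))"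

lemma to_move_append_eq: "to_move (h @ [v]) = P \<longleftrightarrow> to_move h \<noteq> P"
  by (cases P) (auto simp: to_move_def)

lemma finite_play_append:
  "h \<noteq> [] \<Longrightarrow> finite_play M x (h @ [v]) \<longleftrightarrow> finite_play M x h \<and> M (last h) v"
  by (auto simp: finite_play_def successively_append_iff)

lemma follows_append:
  assumes "h \<noteq> []"
  shows "follows P \<sigma> (h @ [v]) \<longleftrightarrow> follows P \<sigma> h \<and> (to_move h = P \<longrightarrow> v = \<sigma> h)"
proof -
  have "follows P \<sigma> (h @ [v]) \<longleftrightarrow>
    (\<forall>n. 0 < n \<and> (n < length h \<or> n = length h) \<and> to_move (take n (h @ [v])) = P \<longrightarrow>
       (h @ [v]) ! n = \<sigma> (take n (h @ [v])))"
    by (auto simp: follows_def less_Suc_eq)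
  also have "\<dots> \<longleftrightarrow> follows P \<sigma> h \<and> (to_move h = P \<longrightarrow> v = \<sigma> h)"
    using assms by (auto simp: follows_def nth_append)
  finally show ?thesis .
qed

text \<open>
  The strategy moves so that the stage of the position drops. The drop keeps the play
  within the histories that are winning for \<open>P\<close>, and it makes the play end, because the stages
  at the moves of \<open>P\<close> strictly decrease.
\<close>

lemma exists_winning_strategy_if_winning_for:
  assumes fin: "\<And>u. finite {v. M u v}" and start: "winning_for M P [x]"
  shows "\<exists>\<sigma>. winning_strategy M x P \<sigma>"
proof -
  define rank where "rank u = (LEAST n. wins_within M n u)" for u
  define \<sigma> where "\<sigma> h = (if won M (last h) then SOME v. M (last h) v \<and> loses_within M (rank (last h)) v
                        else SOME v. M (last h) v)" for h
  have rank: "wins_within M (rank u) u" if "won M u" for u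
    unfolding rank_def using that unfolding won_def by (rule LeastI_ex)
  have \<sigma>_won: "M (last h) (\<sigma> h) \<and> loses_within M (rank (last h)) (\<sigma> h)" if "won M (last h)" for h
    using someI_ex[OF rank[OF that, unfolded wins_within_def]] that by (simp add: \<sigma>_def)
  have step: "winning_for M P (h @ [v])"
    if "winning_for M P h" "M (last h) v" "to_move h = P \<Longrightarrow> v = \<sigma> h" for h v
    using that \<sigma>_won[of h] lost_iff[of M "last h", OF fin]
    by (auto simp: winning_for_def to_move_append_eq lost_def split: if_splits)
  have inv: "winning_for M P h" if "finite_play M x h" "follows P \<sigma> h" for h
    using that
  proof (induction h rule: rev_induct)
    case Nil then show ?case by (simp add: finite_play_def)
  next
    case (snoc v h)
    show ?case
    proof (cases "h = []")
      case True
      with snoc show ?thesis using start by (simp add: finite_play_def)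
    next
      case False
      with snoc show ?thesis by (intro step) (auto simp: finite_play_append follows_append)
    qed
  qed
  have legal: "legal_strategy M P \<sigma>"
    unfolding legal_strategy_def
  proof (intro allI impI)
    fix h :: "'a list" assume h: "h \<noteq> [] \<and> to_move h = P \<and> can_move M (last h)"
    then show "M (last h) (\<sigma> h)"
      using \<sigma>_won[of h] someI_ex[of "M (last h)"] by (auto simp: \<sigma>_def can_move_def)
  qed
  have no_infinite: False if p: "infinite_play M x p" and f: "follows_forever P \<sigma> p" for p
  proof -
    define H where "H n = map p [0..<Suc n]" for n
    have H_Suc: "H (Suc n) = H n @ [p (Suc n)]" for n by (simp add: H_def)
    have H_ne: "H n \<noteq> []" and H_last: "last (H n) = p n" for n by (simp_all add: H_def)
    have H_follows: "follows P \<sigma> (H n)" for n using f unfolding follows_forever_def H_def by blast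
    have H_play: "finite_play M x (H n)" for n
    proof (induction n)
      case 0 then show ?case using p by (simp add: H_def finite_play_def infinite_play_def)
    next
      case (Suc n) then show ?case using p
        by (simp add: H_Suc H_ne H_last finite_play_append infinite_play_def)
    qed
    have good: "winning_for M P (H n)" for n by (rule inv[OF H_play H_follows])
    have descent: "\<not> wins_within M m (p n)" if "to_move (H n) = P" for m n
      using that
    proof (induction m arbitrary: n rule: less_induct)
      case (less m)
      show ?case
      proof
        assume win: "wins_within M m (p n)"
        then have w: "won M (last (H n))" by (auto simp: won_def H_last)
        have "p (Suc n) = \<sigma> (H n)"
          using H_follows[of "Suc n"] less.prems by (simp add: H_Suc H_ne follows_append)
        with \<sigma>_won[OF w] have l: "loses_within M (rank (p n)) (p (Suc n))" by (simp add: H_last)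
        have "rank (p n) \<le> m" unfolding rank_def using win by (rule Least_le)
        moreover from l obtain r where r: "rank (p n) = Suc r" by (cases "rank (p n)") auto
        ultimately have "r < m" by simp
        moreover have "wins_within M r (p (Suc (Suc n)))"
          using l p unfolding r by (auto simp: loses_within_Suc infinite_play_def simp del: loses_within.simps(2))
        moreover have "to_move (H (Suc (Suc n))) = P"
          using less.prems unfolding H_Suc to_move_append_eq by simp
        ultimately show False using less.IH by blast
      qed
    qed
    have "\<exists>n. to_move (H n) = P"
      using to_move_append_eq[of "H 0" "p (Suc 0)" P] H_Suc[of 0] by metis
    then obtain n where n: "to_move (H n) = P" ..
    then have "won M (p n)" using good[of n] by (simp add: winning_for_def H_last)
    with descent[OF n] show False by (auto simp: won_def)
  qed
  have "to_move h \<noteq> P" if "finite_play M x h" "follows P \<sigma> h" "\<not> can_move M (last h)" for h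
    using inv[OF that(1,2)] that(3) by (auto simp: winning_for_def won_iff can_move_def)
  with legal no_infinite show ?thesis
    unfolding winning_strategy_def by blast
qed

text \<open>
  If the starting position is not winning for \<open>P\<close>, then the opponent can answer any \<open>\<sigma>\<close> by always
  moving to a position that is not won for the player \<open>P\<close> who then has to move. Against a winning
  strategy this counterplay never gets stuck: the opponent has a move at every position that is not
  lost, and \<open>P\<close> is not stuck because \<open>\<sigma>\<close> wins. So it yields an infinite play, which is a draw.
\<close>

lemma winning_for_if_winning_strategy:
  assumes fin: "\<And>u. finite {v. M u v}" and win: "winning_strategy M x P \<sigma>"
  shows "winning_for M P [x]"
proof (rule ccontr)
  assume start: "\<not> winning_for M P [x]"
  define nxt where "nxt h = (if to_move h = P then \<sigma> h
      else SOME v. M (last h) v \<and> \<not> won M v)" for h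
  define H where "H n = ((\<lambda>h. h @ [nxt h]) ^^ n) [x]" for n
  have H_0: "H 0 = [x]" and H_Suc: "H (Suc n) = H n @ [nxt (H n)]" for n by (simp_all add: H_def)
  have len: "length (H n) = Suc n" for n by (induction n) (simp_all add: H_0 H_Suc)
  then have H_ne: "H n \<noteq> []" for n by (metis Zero_not_Suc list.size(3))
  have step: "M (last h) (nxt h) \<and> \<not> winning_for M P (h @ [nxt h])"
    if h: "finite_play M x h" "follows P \<sigma> h" "\<not> winning_for M P h" for h
  proof (cases "to_move h = P")
    case True
    have "can_move M (last h)"
      using h True win by (auto simp: winning_strategy_def)
    then have "M (last h) (\<sigma> h)"
      using win h True by (auto simp: winning_strategy_def legal_strategy_def finite_play_def)
    moreover have "\<not> lost M (\<sigma> h)"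
      using calculation h True by (auto simp: winning_for_def won_iff[of M "last h"])
    ultimately show ?thesis using True
      by (simp add: nxt_def winning_for_def to_move_append_eq)
  next
    case False
    then have "\<exists>v. M (last h) v \<and> \<not> won M v"
      using h lost_iff[of M "last h", OF fin] by (auto simp: winning_for_def)
    from someI_ex[OF this] False show ?thesis
      by (simp add: nxt_def winning_for_def to_move_append_eq)
  qed
  have inv: "finite_play M x (H n) \<and> follows P \<sigma> (H n) \<and> \<not> winning_for M P (H n)" for n
  proof (induction n)
    case 0 then show ?case using start by (simp add: H_0 finite_play_def follows_def)
  next
    case (Suc n)
    with step[of "H n"] show ?case
      by (auto simp: H_Suc H_ne finite_play_append follows_append nxt_def)
  qed
  define p where "p n = last (H n)" for n
  have p_H: "map p [0..<Suc n] = H n" for n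
  proof (induction n)
    case 0 then show ?case by (simp add: p_def H_0)
  next
    case (Suc n)
    then show ?case by (simp add: p_def H_Suc)
  qed
  have "infinite_play M x p"
    using step inv by (auto simp: infinite_play_def p_def H_0 H_Suc)
  moreover have "follows P \<sigma> (map p [0..<n])" for n
  proof (cases n)
    case (Suc m) with inv[of m] show ?thesis by (simp only: p_H)
  qed (simp add: follows_def)
  then have "follows_forever P \<sigma> p" by (simp add: follows_forever_def)
  ultimately show False using win by (auto simp: winning_strategy_def)
qed

lemma first_player_wins_iff_won:
  "(\<And>u. finite {v. M u v}) \<Longrightarrow> first_player_wins M x \<longleftrightarrow> won M x"
  using exists_winning_strategy_if_winning_for[of M First x] winning_for_if_winning_strategy[of M x First]
  by (auto simp: first_player_wins_def winning_for_def to_move_def)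

lemma first_player_loses_iff_lost:
  "(\<And>u. finite {v. M u v}) \<Longrightarrow> first_player_loses M x \<longleftrightarrow> lost M x"
  using exists_winning_strategy_if_winning_for[of M Second x] winning_for_if_winning_strategy[of M x Second]
  by (auto simp: first_player_loses_def winning_for_def to_move_def)

section \<open>Locality of the jump game\<close>

definition subtree :: "vertex \<Rightarrow> (vertex \<Rightarrow> nat) \<Rightarrow> vertex \<Rightarrow> nat" where
  "subtree u \<omega> = (\<lambda>v. \<omega> (u @ v))"

lemma Nil_in_tree [simp]: "[] \<in> tree \<omega>" by (rule tree.root)

lemma snoc_in_tree_iff: "v @ [i] \<in> tree \<omega> \<longleftrightarrow> v \<in> tree \<omega> \<and> i < \<omega> v"
  by (auto intro: tree.child elim: tree.cases)

lemma append_in_tree_iff: "u @ v \<in> tree \<omega> \<longleftrightarrow> u \<in> tree \<omega> \<and> v \<in> tree (subtree u \<omega>)"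
proof (induction v rule: rev_induct)
  case (snoc i v)
  have "u @ v @ [i] \<in> tree \<omega> \<longleftrightarrow> (u @ v) @ [i] \<in> tree \<omega>" by simp
  then show ?case unfolding snoc_in_tree_iff using snoc by (auto simp: subtree_def)
qed simp

lemma singleton_in_tree_iff [simp]: "[i] \<in> tree \<omega> \<longleftrightarrow> i < \<omega> []"
  using snoc_in_tree_iff[of "[]"] by simp

lemma finite_tree_level: "finite {v \<in> tree \<omega>. length v \<le> n}"
proof (induction n)
  case 0
  show ?case by (rule finite_subset[of _ "{[]}"]) auto
next
  case (Suc n)
  have "{v \<in> tree \<omega>. length v \<le> Suc n} \<subseteq>
      insert [] (\<Union>u\<in>{v \<in> tree \<omega>. length v \<le> n}. (\<lambda>i. u @ [i]) ` {..<\<omega> u})"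
  proof
    fix v assume v: "v \<in> {v \<in> tree \<omega>. length v \<le> Suc n}"
    then show "v \<in> insert [] (\<Union>u\<in>{v \<in> tree \<omega>. length v \<le> n}. (\<lambda>i. u @ [i]) ` {..<\<omega> u})"
      by (cases v rule: rev_cases) (auto simp: snoc_in_tree_iff)
  qed
  then show ?case by (rule finite_subset) (use Suc in auto)
qed

lemma finite_jump: "finite {v. jump k \<omega> u v}"
proof (rule finite_subset[OF _ finite_tree_level])
  show "{v. jump k \<omega> u v} \<subseteq> {v \<in> tree \<omega>. length v \<le> length u + k}"
    by (auto simp: jump_def)
qed

lemma jump_subtree:
  "u \<in> tree \<omega> \<Longrightarrow> jump k \<omega> (u @ v) w \<longleftrightarrow> (\<exists>w'. w = u @ w' \<and> jump k (subtree u \<omega>) v w')"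
  by (auto simp: jump_def append_in_tree_iff strict_prefix_def prefix_def)

text \<open>
  Moves only lead to descendants, so the outcome at \<open>u\<close> is a function of the subtree hanging at
  \<open>u\<close>. This turns the recursion over positions of one tree into a recursion over independent
  random trees.
\<close>

lemma loses_within_subtree:
  "u \<in> tree \<omega> \<Longrightarrow> loses_within (jump k \<omega>) n (u @ v) \<longleftrightarrow> loses_within (jump k (subtree u \<omega>)) n v"
proof (induction n arbitrary: v)
  case (Suc n)
  show ?case
    by (simp add: jump_subtree[OF Suc.prems])
      (metis (no_types, lifting) Suc.IH Suc.prems jump_subtree)
qed simp

lemma wins_within_subtree:
  "u \<in> tree \<omega> \<Longrightarrow> wins_within (jump k \<omega>) n (u @ v) \<longleftrightarrow> wins_within (jump k (subtree u \<omega>)) n v"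
  unfolding wins_within_def using jump_subtree loses_within_subtree by metis

lemma jump_1_root: "jump 1 \<omega> [] v \<longleftrightarrow> (\<exists>i<\<omega> []. v = [i])"
proof -
  have "jump 1 \<omega> [] v \<longleftrightarrow> v \<in> tree \<omega> \<and> length v = 1"
    by (cases v) (auto simp: jump_def strict_prefix_def)
  then show ?thesis by (auto simp: length_Suc_conv)
qed

lemma Cons_in_tree_iff: "[i, j] \<in> tree \<omega> \<longleftrightarrow> i < \<omega> [] \<and> j < subtree [i] \<omega> []"
  using append_in_tree_iff[of "[i]" "[j]" \<omega>] by simp

lemma jump_2_root:
  "jump 2 \<omega> [] v \<longleftrightarrow> (\<exists>i<\<omega> []. v = [i] \<or> (\<exists>j<subtree [i] \<omega> []. v = [i] @ [j]))"
proof -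
  have "jump 2 \<omega> [] v \<longleftrightarrow> v \<in> tree \<omega> \<and> (length v = 1 \<or> length v = 2)"
    by (cases v) (auto simp: jump_def strict_prefix_def le_Suc_eq numeral_2_eq_2)
  also have "\<dots> \<longleftrightarrow> (\<exists>i. v = [i] \<and> v \<in> tree \<omega>) \<or> (\<exists>i j. v = [i, j] \<and> v \<in> tree \<omega>)"
    by (auto simp: length_Suc_conv numeral_2_eq_2)
  also have "\<dots> \<longleftrightarrow> (\<exists>i<\<omega> []. v = [i] \<or> (\<exists>j<subtree [i] \<omega> []. v = [i] @ [j]))"
    using Cons_in_tree_iff by auto
  finally show ?thesis .
qed

section \<open>The branching property of the Galton-Watson tree\<close>

lemma measurable_in_tree: "Measurable.pred (GW lam) (\<lambda>\<omega>. v \<in> tree \<omega>)"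
proof (induction v rule: rev_induct)
  case (snoc i v)
  have "(\<lambda>\<omega>. \<omega> v) \<in> measurable (GW lam) (count_space UNIV)"
    unfolding GW_def by measurable
  with snoc show ?case unfolding snoc_in_tree_iff by measurable
qed simp

lemma measurable_jump [measurable]: "Measurable.pred (GW lam) (\<lambda>\<omega>. jump k \<omega> u v)"
  unfolding jump_def using measurable_in_tree[measurable] by measurable

lemma measurable_loses_within [measurable]: "Measurable.pred (GW lam) (\<lambda>\<omega>. loses_within (jump k \<omega>) n u)"
proof (induction n arbitrary: u)
  case (Suc n)
  show ?case using Suc[measurable] unfolding loses_within.simps by measurable
qed simp

lemma measurable_wins_within [measurable]: "Measurable.pred (GW lam) (\<lambda>\<omega>. wins_within (jump k \<omega>) n u)"
  unfolding wins_within_def by measurable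

lemma space_GW: "space (GW lam) = UNIV"
  by (simp add: GW_def space_PiM PiE_UNIV_domain)

interpretation GW: prob_space "GW lam" for lam
  unfolding GW_def by (intro prob_space_PiM prob_space_measure_pmf)

lemma measurable_offspring [measurable]: "(\<lambda>\<omega>. \<omega> v) \<in> measurable (GW lam) (count_space UNIV)"
  unfolding GW_def by measurable

lemma measurable_subtree [measurable]: "subtree u \<in> measurable (GW lam) (GW lam)"
  unfolding subtree_def
  by (subst (2) GW_def, rule measurable_PiM_single') (auto simp: space_PiM PiE_UNIV_domain)

lemma distr_offspring:
  "distr (GW lam) (measure_pmf (poisson_pmf lam)) (\<lambda>\<omega>. \<omega> v) = measure_pmf (poisson_pmf lam)"
  unfolding GW_def by (rule distr_PiM_component) (auto simp: prob_space_measure_pmf)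

text \<open>
  The label map \<open>v \<mapsto> u @ v\<close> is injective, and reindexing an i.i.d. family along an injection gives
  the same i.i.d. family.
\<close>

lemma distr_subtree: "distr (GW lam) (GW lam) (subtree u) = GW lam"
proof -
  have "distr (GW lam) (GW lam) (\<lambda>\<omega>. \<lambda>v\<in>UNIV. \<omega> (u @ v)) = GW lam"
    unfolding GW_def
    by (rule distr_PiM_reindex) (auto simp: prob_space_measure_pmf inj_on_def)
  moreover have "(\<lambda>\<omega>. \<lambda>v\<in>UNIV. \<omega> (u @ v)) = subtree u"
    by (simp add: fun_eq_iff subtree_def)
  ultimately show ?thesis by simp
qed

lemma prob_subtree:
  assumes [measurable]: "Measurable.pred (GW lam) P"
  shows "\<P>(\<omega> in GW lam. P (subtree u \<omega>)) = \<P>(\<omega> in GW lam. P \<omega>)"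
proof -
  have "\<P>(\<omega> in GW lam. P \<omega>) =
      measure (distr (GW lam) (GW lam) (subtree u)) {\<omega> \<in> space (GW lam). P \<omega>}"
    by (simp add: distr_subtree)
  also have "\<dots> = measure (GW lam) (subtree u -` {\<omega> \<in> space (GW lam). P \<omega>} \<inter> space (GW lam))"
    by (rule measure_distr) measurable
  also have "\<dots> = \<P>(\<omega> in GW lam. P (subtree u \<omega>))"
    by (simp add: space_GW vimage_def)
  finally show ?thesis ..
qed

lemma prob_offspring:
  assumes "0 < lam"
  shows "\<P>(\<omega> in GW lam. \<omega> v = n) = lam ^ n / fact n * exp (- lam)"
proof -
  have "measure_pmf.prob (poisson_pmf lam) {n} =
      measure (distr (GW lam) (measure_pmf (poisson_pmf lam)) (\<lambda>\<omega>. \<omega> v)) {n}"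
    by (simp add: distr_offspring)
  also have "\<dots> = measure (GW lam) ((\<lambda>\<omega>. \<omega> v) -` {n} \<inter> space (GW lam))"
    by (rule measure_distr) auto
  also have "\<dots> = \<P>(\<omega> in GW lam. \<omega> v = n)"
    by (simp add: space_GW vimage_def)
  finally show ?thesis using pmf_poisson[OF assms] by (simp add: measure_pmf_single)
qed

text \<open>
  The label of the root and the label families of the subtrees at \<open>[0]\<close>, \<open>[1]\<close>, ... depend on the
  disjoint blocks \<open>{[]}\<close> and \<open>range ((#) i)\<close> of independent coordinates, hence are independent. All
  conceivable children are considered here, existing or not, which decouples the subtrees from the
  number of children.
\<close>

lemma prob_first_children:
  assumes [measurable]: "Measurable.pred (GW lam) P"
  shows "\<P>(\<omega> in GW lam. \<omega> [] = n \<and> (\<forall>i<n. P (subtree [i] \<omega>))) =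
    \<P>(\<omega> in GW lam. \<omega> [] = n) * \<P>(\<omega> in GW lam. P \<omega>) ^ n"
proof -
  let ?N = "measure_pmf (poisson_pmf lam)"
  \<comment> \<open>Block \<open>0\<close> is the root, block \<open>i + 1\<close> the potential subtree at the child \<open>[i]\<close>.\<close>
  define K :: "nat \<Rightarrow> vertex set" where "K = case_nat {[]} (\<lambda>i. range ((#) i))"
  have coords: "GW.indep_vars lam (\<lambda>_. ?N) (\<lambda>v \<omega>. \<omega> v) UNIV"
    by (subst GW.indep_vars_iff_distr_eq_PiM') (auto simp: distr_offspring restrict_def GW_def[symmetric])
  have blocks: "GW.indep_vars lam (\<lambda>j. PiM (K j) (\<lambda>_. ?N)) (\<lambda>j \<omega>. restrict (\<lambda>v. \<omega> v) (K j)) UNIV"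
    by (rule GW.indep_vars_restrict[OF coords])
       (auto simp: K_def disjoint_family_on_def split: nat.splits)
  define E :: "nat \<Rightarrow> (vertex \<Rightarrow> nat) \<Rightarrow> bool" where
    "E = case_nat (\<lambda>x. x [] = n) (\<lambda>i x. P (\<lambda>v. x (i # v)))"
  have E: "Measurable.pred (PiM (K j) (\<lambda>_. ?N)) (E j)" for j
  proof (cases j)
    case 0
    have "(\<lambda>x. x []) \<in> measurable (PiM {[]} (\<lambda>_. ?N)) (count_space UNIV)"
      by (rule measurable_compose[OF measurable_component_singleton]) auto
    then have "Measurable.pred (PiM {[]} (\<lambda>_. ?N)) (\<lambda>x. x [] = n)" by measurable
    with 0 show ?thesis by (simp add: E_def K_def)
  next
    case (Suc i)
    have "(\<lambda>x v. x (i # v)) \<in> measurable (PiM (range ((#) i)) (\<lambda>_. ?N)) (GW lam)"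
      unfolding GW_def
      by (rule measurable_PiM_single')
        (auto simp: space_PiM PiE_UNIV_domain intro!: measurable_component_singleton
           simp del: measurable_pmf_measure2)
    from measurable_compose[OF this assms] Suc show ?thesis by (simp add: E_def K_def)
  qed
  have "GW.indep_vars lam (\<lambda>_. count_space UNIV) (\<lambda>j \<omega>. E j (restrict (\<lambda>v. \<omega> v) (K j))) UNIV"
    by (rule GW.indep_vars_compose2[OF blocks E])
  from GW.indep_varsD[OF this, of "{..n}" "\<lambda>_. {True}"]
  have "measure (GW lam) (\<Inter>j\<in>{..n}. {\<omega>. E j (restrict (\<lambda>v. \<omega> v) (K j))}) =
      (\<Prod>j\<le>n. measure (GW lam) {\<omega>. E j (restrict (\<lambda>v. \<omega> v) (K j))})"
    by (simp add: vimage_def space_GW)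
  also have "(\<Inter>j\<in>{..n}. {\<omega>. E j (restrict (\<lambda>v. \<omega> v) (K j))}) =
      {\<omega>. \<omega> [] = n \<and> (\<forall>i<n. P (subtree [i] \<omega>))}"
  proof -
    have "(\<forall>j\<le>n. E j (restrict (\<lambda>v. \<omega> v) (K j))) \<longleftrightarrow>
       E 0 (restrict (\<lambda>v. \<omega> v) (K 0)) \<and> (\<forall>i<n. E (Suc i) (restrict (\<lambda>v. \<omega> v) (K (Suc i))))" for \<omega>
      by (metis Suc_leI le0 less_eq_Suc_le not0_implies_Suc)
    then show ?thesis by (auto simp: E_def K_def subtree_def)
  qed
  also have "(\<Prod>j\<le>n. measure (GW lam) {\<omega>. E j (restrict (\<lambda>v. \<omega> v) (K j))}) =
      \<P>(\<omega> in GW lam. \<omega> [] = n) * (\<Prod>i<n. \<P>(\<omega> in GW lam. P (subtree [i] \<omega>)))"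
    by (subst prod.atMost_shift) (simp add: E_def K_def subtree_def space_GW)
  finally show ?thesis using prob_subtree[OF assms] by (simp add: space_GW)
qed

text \<open>
  The probability generating function of the Poisson distribution, evaluated at the probability
  of \<open>P\<close>. Every recursion below is an instance of this formula or of its complement.
\<close>

lemma prob_all_children:
  assumes "0 < lam" and [measurable]: "Measurable.pred (GW lam) P"
  shows "\<P>(\<omega> in GW lam. \<forall>i<\<omega> []. P (subtree [i] \<omega>)) = exp (- lam * (1 - \<P>(\<omega> in GW lam. P \<omega>)))"
proof -
  define p where "p = \<P>(\<omega> in GW lam. P \<omega>)"
  define A where "A n = {\<omega> \<in> space (GW lam). \<omega> [] = n \<and> (\<forall>i<n. P (subtree [i] \<omega>))}" for n
  have "range A \<subseteq> sets (GW lam)" unfolding A_def by (intro image_subsetI) measurable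
  moreover have "disjoint_family A" by (auto simp: A_def disjoint_family_on_def)
  ultimately have "(\<lambda>n. measure (GW lam) (A n)) sums measure (GW lam) (\<Union>n. A n)"
    by (rule GW.finite_measure_UNION)
  moreover have "(\<Union>n. A n) = {\<omega> \<in> space (GW lam). \<forall>i<\<omega> []. P (subtree [i] \<omega>)}"
    by (auto simp: A_def)
  moreover have "measure (GW lam) (A n) = exp (- lam) * ((lam * p) ^ n /\<^sub>R fact n)" for n
    unfolding A_def using prob_first_children[OF assms(2), of n] prob_offspring[OF assms(1)]
    by (simp add: p_def power_mult_distrib field_simps)
  moreover have "(\<lambda>n. exp (- lam) * ((lam * p) ^ n /\<^sub>R fact n)) sums (exp (- lam) * exp (lam * p))"
    by (intro sums_mult exp_converges)
  ultimately have "\<P>(\<omega> in GW lam. \<forall>i<\<omega> []. P (subtree [i] \<omega>)) = exp (- lam) * exp (lam * p)"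
    by (metis (no_types, lifting) sums_cong sums_unique2)
  then show ?thesis by (simp add: p_def mult_exp_exp algebra_simps)
qed

lemma prob_some_child:
  assumes "0 < lam" and [measurable]: "Measurable.pred (GW lam) P"
  shows "\<P>(\<omega> in GW lam. \<exists>i<\<omega> []. P (subtree [i] \<omega>)) = 1 - exp (- lam * \<P>(\<omega> in GW lam. P \<omega>))"
proof -
  have neg: "\<P>(\<omega> in GW lam. \<not> Q \<omega>) = 1 - \<P>(\<omega> in GW lam. Q \<omega>)" if "Measurable.pred (GW lam) Q" for Q
    using GW.prob_neg[of lam Q] that by (simp add: pred_def)
  have "\<P>(\<omega> in GW lam. \<forall>i<\<omega> []. \<not> P (subtree [i] \<omega>)) = exp (- lam * \<P>(\<omega> in GW lam. P \<omega>))"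
    by (subst prob_all_children) (use assms in \<open>auto simp: neg\<close>)
  moreover have "\<P>(\<omega> in GW lam. \<forall>i<\<omega> []. \<not> P (subtree [i] \<omega>)) =
     1 - \<P>(\<omega> in GW lam. \<exists>i<\<omega> []. P (subtree [i] \<omega>))"
    by (subst neg[symmetric]) (auto intro!: arg_cong[where f="measure (GW lam)"])
  ultimately show ?thesis by simp
qed

section \<open>Recursive description of the outcome at the root\<close>

abbreviation root_lost :: "nat \<Rightarrow> (vertex \<Rightarrow> nat) \<Rightarrow> bool" where
  "root_lost k \<omega> \<equiv> lost (jump k \<omega>) []"

abbreviation root_won :: "nat \<Rightarrow> (vertex \<Rightarrow> nat) \<Rightarrow> bool" where
  "root_won k \<omega> \<equiv> won (jump k \<omega>) []"

lemma lost_subtree: "u \<in> tree \<omega> \<Longrightarrow> lost (jump k \<omega>) u \<longleftrightarrow> root_lost k (subtree u \<omega>)"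
  using loses_within_subtree[of u \<omega> k _ "[]"] by (simp add: lost_def)

lemma won_subtree: "u \<in> tree \<omega> \<Longrightarrow> won (jump k \<omega>) u \<longleftrightarrow> root_won k (subtree u \<omega>)"
  using wins_within_subtree[of u \<omega> k _ "[]"] by (simp add: won_def)

lemma subtree_append: "subtree (u @ v) \<omega> = subtree v (subtree u \<omega>)"
  by (simp add: subtree_def)

lemma root_lost_1_iff: "root_lost 1 \<omega> \<longleftrightarrow> (\<forall>i<\<omega> []. root_won 1 (subtree [i] \<omega>))"
  unfolding lost_iff[OF finite_jump] jump_1_root using won_subtree[of "[_]"] by auto

lemma root_won_1_iff: "root_won 1 \<omega> \<longleftrightarrow> (\<exists>i<\<omega> []. root_lost 1 (subtree [i] \<omega>))"
  unfolding won_iff[of _ "[]"] jump_1_root using lost_subtree[of "[_]"] by auto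

text \<open>
  Transfers a property that only depends on the hanging subtree from children and grandchildren of
  the root to iterated child subtrees.
\<close>

lemma two_levels:
  assumes "\<And>u. u \<in> tree \<omega> \<Longrightarrow> P \<omega> u \<longleftrightarrow> P (subtree u \<omega>) []"
    and "i < \<omega> []"
  shows "P \<omega> [i] \<longleftrightarrow> P (subtree [i] \<omega>) []"
    and "j < subtree [i] \<omega> [] \<Longrightarrow> P \<omega> ([i] @ [j]) \<longleftrightarrow> P (subtree [j] (subtree [i] \<omega>)) []"
proof -
  show "P \<omega> [i] \<longleftrightarrow> P (subtree [i] \<omega>) []" using assms by simp
  show "P \<omega> ([i] @ [j]) \<longleftrightarrow> P (subtree [j] (subtree [i] \<omega>)) []" if "j < subtree [i] \<omega> []"
    unfolding subtree_append[symmetric] using assms that by (intro assms(1)) (simp add: Cons_in_tree_iff)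
qed

lemma root_lost_2_iff:
  "root_lost 2 \<omega> \<longleftrightarrow> (\<forall>i<\<omega> []. root_won 2 (subtree [i] \<omega>) \<and>
      (\<forall>j<subtree [i] \<omega> []. root_won 2 (subtree [j] (subtree [i] \<omega>))))"
  unfolding lost_iff[OF finite_jump] jump_2_root
  using two_levels[of \<omega> "\<lambda>\<omega> u. won (jump 2 \<omega>) u", OF won_subtree] by metis

lemma root_won_2_iff:
  "root_won 2 \<omega> \<longleftrightarrow> (\<exists>i<\<omega> []. root_lost 2 (subtree [i] \<omega>) \<or>
      (\<exists>j<subtree [i] \<omega> []. root_lost 2 (subtree [j] (subtree [i] \<omega>))))"
  unfolding won_iff[of _ "[]"] jump_2_root
  using two_levels[of \<omega> "\<lambda>\<omega> u. lost (jump 2 \<omega>) u", OF lost_subtree] by metis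

lemma measurable_lost [measurable]: "Measurable.pred (GW lam) (\<lambda>\<omega>. lost (jump k \<omega>) u)"
  unfolding lost_def by measurable

lemma measurable_won [measurable]: "Measurable.pred (GW lam) (\<lambda>\<omega>. won (jump k \<omega>) u)"
  unfolding won_def by measurable

lemma nl_eq: "nl k lam = \<P>(\<omega> in GW lam. root_lost k \<omega>)"
  by (simp add: nl_def first_player_loses_iff_lost finite_jump)

lemma nw_eq: "nw k lam = \<P>(\<omega> in GW lam. root_won k \<omega>)"
  by (simp add: nw_def first_player_wins_iff_won finite_jump)

section \<open>Outcome probabilities\<close>

lemma prob_disjoint_disj:
  assumes [measurable]: "Measurable.pred (GW lam) P" "Measurable.pred (GW lam) Q"
    and "\<And>\<omega>. P \<omega> \<Longrightarrow> \<not> Q \<omega>"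
  shows "\<P>(\<omega> in GW lam. P \<omega> \<or> Q \<omega>) = \<P>(\<omega> in GW lam. P \<omega>) + \<P>(\<omega> in GW lam. Q \<omega>)"
proof -
  have "{\<omega> \<in> space (GW lam). P \<omega> \<or> Q \<omega>} = {\<omega> \<in> space (GW lam). P \<omega>} \<union> {\<omega> \<in> space (GW lam). Q \<omega>}"
    by auto
  then show ?thesis
    using assms(3) by (simp add: GW.finite_measure_Union disjoint_iff)
qed

lemma prob_imp_diff:
  assumes [measurable]: "Measurable.pred (GW lam) P" "Measurable.pred (GW lam) Q"
    and "\<And>\<omega>. Q \<omega> \<Longrightarrow> P \<omega>"
  shows "\<P>(\<omega> in GW lam. P \<omega> \<and> \<not> Q \<omega>) = \<P>(\<omega> in GW lam. P \<omega>) - \<P>(\<omega> in GW lam. Q \<omega>)"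
proof -
  have "\<P>(\<omega> in GW lam. Q \<omega> \<or> (P \<omega> \<and> \<not> Q \<omega>)) =
      \<P>(\<omega> in GW lam. Q \<omega>) + \<P>(\<omega> in GW lam. P \<omega> \<and> \<not> Q \<omega>)"
    by (rule prob_disjoint_disj) auto
  moreover have "(Q \<omega> \<or> (P \<omega> \<and> \<not> Q \<omega>)) = P \<omega>" for \<omega> using assms(3) by blast
  ultimately show ?thesis by simp
qed

lemma nd_eq: "nd k lam = 1 - nw k lam - nl k lam"
proof -
  have "nd k lam = \<P>(\<omega> in GW lam. \<not> (root_won k \<omega> \<or> root_lost k \<omega>))"
    by (simp add: nd_def game_drawn_def first_player_wins_iff_won first_player_loses_iff_lost finite_jump)
  also have "\<dots> = 1 - \<P>(\<omega> in GW lam. root_won k \<omega> \<or> root_lost k \<omega>)"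
    by (rule GW.prob_neg) measurable
  also have "\<P>(\<omega> in GW lam. root_won k \<omega> \<or> root_lost k \<omega>) = nw k lam + nl k lam"
    unfolding nl_eq nw_eq by (rule prob_disjoint_disj) (auto dest: not_won_and_lost)
  finally show ?thesis by simp
qed

lemma one_minus_exp_le: "1 - exp (- x) \<le> (x::real)"
  using exp_ge_add_one_self[of "- x"] by simp

lemma prob_some_child_le:
  assumes "0 < lam" and [measurable]: "Measurable.pred (GW lam) P"
  shows "\<P>(\<omega> in GW lam. \<exists>i<\<omega> []. P (subtree [i] \<omega>)) \<le> lam * \<P>(\<omega> in GW lam. P \<omega>)"
  unfolding prob_some_child[OF assms] using one_minus_exp_le[of "lam * \<P>(\<omega> in GW lam. P \<omega>)"] by simp

lemma prob_some_grandchild_le: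
  assumes lam: "0 < lam" and [measurable]: "Measurable.pred (GW lam) P"
  shows "\<P>(\<omega> in GW lam. \<exists>i<\<omega> []. P (subtree [i] \<omega>) \<or>
      (\<exists>j<subtree [i] \<omega> []. P (subtree [j] (subtree [i] \<omega>)))) \<le> lam * (1 + lam) * \<P>(\<omega> in GW lam. P \<omega>)"
proof -
  let ?R = "\<lambda>\<omega>. \<exists>j<\<omega> []. P (subtree [j] \<omega>)"
  have "\<P>(\<omega> in GW lam. \<exists>i<\<omega> []. P (subtree [i] \<omega>) \<or> ?R (subtree [i] \<omega>))
      \<le> lam * \<P>(\<omega> in GW lam. P \<omega> \<or> ?R \<omega>)"
    by (rule prob_some_child_le[OF lam]) measurable
  also have "\<P>(\<omega> in GW lam. P \<omega> \<or> ?R \<omega>) \<le> \<P>(\<omega> in GW lam. P \<omega>) + \<P>(\<omega> in GW lam. ?R \<omega>)"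
    unfolding Collect_disj_eq conj_disj_distribL by (rule measure_Un_le) measurable
  also have "\<P>(\<omega> in GW lam. ?R \<omega>) \<le> lam * \<P>(\<omega> in GW lam. P \<omega>)"
    by (rule prob_some_child_le[OF lam]) measurable
  finally show ?thesis using lam by (simp add: algebra_simps mult_left_mono)
qed

text \<open>
  The outcome probabilities are the values reached from below by the stages, not arbitrary solutions
  of the fixed point equations. Smallness must therefore be shown along the stages: if at most a
  quarter of the trees are won at stage \<open>n\<close>, a tree is lost at the next stage with probability at
  most \<open>exp (- 3/4 lam)\<close>, and by a union bound over children and grandchildren it is won with
  probability at most \<open>lam * (1 + lam)\<close> times that. For \<open>k = 1\<close> these bounds are not sharp, but they suffice.
\<close>

lemma nw_le_quarter:
  assumes k: "k \<in> {1, 2}" and lam: "0 < lam" "lam * (1 + lam) * exp (- (3/4) * lam) \<le> 1/4"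
  shows "nw k lam \<le> 1/4"
proof -
  define p where "p n = \<P>(\<omega> in GW lam. loses_within (jump k \<omega>) n [])" for n
  define w where "w n = \<P>(\<omega> in GW lam. wins_within (jump k \<omega>) n [])" for n
  have w_le: "w n \<le> lam * (1 + lam) * p n" for n
  proof -
    have "w n \<le> \<P>(\<omega> in GW lam. \<exists>i<\<omega> []. loses_within (jump k (subtree [i] \<omega>)) n [] \<or>
      (\<exists>j<subtree [i] \<omega> []. loses_within (jump k (subtree [j] (subtree [i] \<omega>))) n []))"
      unfolding w_def
    proof (rule GW.finite_measure_mono)
      show "{\<omega> \<in> space (GW lam). wins_within (jump k \<omega>) n []} \<subseteq>
        {\<omega> \<in> space (GW lam). \<exists>i<\<omega> []. loses_within (jump k (subtree [i] \<omega>)) n [] \<or>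
          (\<exists>j<subtree [i] \<omega> []. loses_within (jump k (subtree [j] (subtree [i] \<omega>))) n [])}"
      proof (intro Collect_mono impI conjI)
        fix \<omega> assume "\<omega> \<in> space (GW lam) \<and> wins_within (jump k \<omega>) n []"
        then obtain v where v: "jump k \<omega> [] v" "loses_within (jump k \<omega>) n v"
          by (auto simp: wins_within_def)
        \<comment> \<open>Allowing jumps of length two only enlarges the set of candidate moves in the union bound.\<close>
        then have "jump 2 \<omega> [] v" using k by (auto simp: jump_def)
        then show "\<exists>i<\<omega> []. loses_within (jump k (subtree [i] \<omega>)) n [] \<or>
          (\<exists>j<subtree [i] \<omega> []. loses_within (jump k (subtree [j] (subtree [i] \<omega>))) n [])"
          using v(2) loses_within_subtree[of _ \<omega> k n "[]"]
            two_levels[of \<omega> "\<lambda>\<omega>. loses_within (jump k \<omega>) n"]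
          unfolding jump_2_root append_Nil2 by metis
      qed auto
    qed measurable
    also have "\<dots> \<le> lam * (1 + lam) * p n"
      unfolding p_def by (rule prob_some_grandchild_le[OF lam(1)]) measurable
    finally show ?thesis .
  qed
  have p_Suc: "p (Suc n) \<le> exp (- lam * (1 - w n))" for n
  proof -
    have "p (Suc n) \<le> \<P>(\<omega> in GW lam. \<forall>i<\<omega> []. wins_within (jump k (subtree [i] \<omega>)) n [])"
      unfolding p_def
    proof (rule GW.finite_measure_mono)
      show "{\<omega> \<in> space (GW lam). loses_within (jump k \<omega>) (Suc n) []} \<subseteq>
        {\<omega> \<in> space (GW lam). \<forall>i<\<omega> []. wins_within (jump k (subtree [i] \<omega>)) n []}"
      proof (intro Collect_mono impI conjI allI)
        fix \<omega> i assume *: "\<omega> \<in> space (GW lam) \<and> loses_within (jump k \<omega>) (Suc n) []" and i: "i < \<omega> []"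
        have "jump k \<omega> [] [i]" using k i by (auto simp: jump_def)
        with * have "wins_within (jump k \<omega>) n [i]" unfolding loses_within_Suc by blast
        then show "wins_within (jump k (subtree [i] \<omega>)) n []"
          using wins_within_subtree[of "[i]" \<omega> k n "[]"] i by simp
      qed auto
    qed measurable
    also have "\<dots> = exp (- lam * (1 - w n))"
      unfolding w_def by (rule prob_all_children[OF lam(1)]) measurable
    finally show ?thesis .
  qed
  have w_quarter: "w n \<le> 1/4" for n
  proof (induction n)
    case 0
    then show ?case by (simp add: w_def wins_within_def)
  next
    case (Suc n)
    have "- lam * (1 - w n) \<le> - (3/4) * lam"
      using mult_left_mono[OF Suc less_imp_le[OF lam(1)]] by (simp add: algebra_simps)
    with p_Suc[of n] have "p (Suc n) \<le> exp (- (3/4) * lam)"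
      by (meson exp_le_cancel_iff order_trans)
    with w_le[of "Suc n"] have "w (Suc n) \<le> lam * (1 + lam) * exp (- (3/4) * lam)"
      using lam(1) by (meson mult_left_mono mult_nonneg_nonneg add_nonneg_nonneg order_trans zero_le_one less_imp_le)
    with lam(2) show ?case by simp
  qed
  have "(\<lambda>n. measure (GW lam) {\<omega> \<in> space (GW lam). wins_within (jump k \<omega>) n []})
      \<longlonglongrightarrow> measure (GW lam) (\<Union>n. {\<omega> \<in> space (GW lam). wins_within (jump k \<omega>) n []})"
  proof (rule GW.finite_Lim_measure_incseq)
    show "range (\<lambda>n. {\<omega> \<in> space (GW lam). wins_within (jump k \<omega>) n []}) \<subseteq> sets (GW lam)"
      by (intro image_subsetI) measurable
    show "incseq (\<lambda>n. {\<omega> \<in> space (GW lam). wins_within (jump k \<omega>) n []})"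
      by (auto intro!: incseq_SucI wins_within_mono[of n "Suc n" for n])
  qed
  moreover have "(\<Union>n. {\<omega> \<in> space (GW lam). wins_within (jump k \<omega>) n []}) =
      {\<omega> \<in> space (GW lam). root_won k \<omega>}"
    by (auto simp: won_def)
  ultimately have "w \<longlonglongrightarrow> nw k lam" by (simp add: w_def[abs_def] nw_eq)
  then show ?thesis by (rule LIMSEQ_le_const2) (use w_quarter in auto)
qed

lemma nl_1: "0 < lam \<Longrightarrow> nl 1 lam = exp (- lam * (1 - nw 1 lam))"
  unfolding nl_eq nw_eq root_lost_1_iff[of "_ :: vertex \<Rightarrow> nat"]
  by (rule prob_all_children) measurable

lemma nw_1: "0 < lam \<Longrightarrow> nw 1 lam = 1 - exp (- lam * nl 1 lam)"
  unfolding nl_eq nw_eq root_won_1_iff[of "_ :: vertex \<Rightarrow> nat"]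
  by (rule prob_some_child) measurable

text \<open>
  The move range of two levels is split into two steps of one level each. Call \<open>R\<close> the trees
  with a lost child and \<open>B\<close> those all of whose children are won. A tree is won iff some child is
  lost or in \<open>R\<close>, and lost iff every child is both won and in \<open>B\<close>. Here \<open>r\<close> is the probability
  of \<open>R\<close> and \<open>q\<close> the probability of being won and in \<open>B\<close>. In \<open>B\<close> no child is lost, so
  being won then means having a child in \<open>R\<close>; this gives the formula for \<open>q\<close>.
\<close>

lemma two_jump_equations:
  assumes lam: "0 < lam"
  obtains q r where
    "nl 2 lam = exp (- lam * (1 - q))"
    "nw 2 lam = 1 - exp (- lam * (nl 2 lam + r))"
    "r = 1 - exp (- lam * nl 2 lam)"
    "q = exp (- lam * (1 - nw 2 lam)) - exp (- lam * (1 - nw 2 lam + r))"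
    "0 \<le> q" "q \<le> nw 2 lam"
proof -
  define R where "R \<omega> \<longleftrightarrow> (\<exists>i<\<omega> []. root_lost 2 (subtree [i] \<omega>))" for \<omega> :: "vertex \<Rightarrow> nat"
  define B where "B \<omega> \<longleftrightarrow> (\<forall>i<\<omega> []. root_won 2 (subtree [i] \<omega>))" for \<omega> :: "vertex \<Rightarrow> nat"
  have [measurable]: "Measurable.pred (GW lam) R" unfolding R_def by measurable
  have [measurable]: "Measurable.pred (GW lam) B" unfolding B_def by measurable
  define r where "r = \<P>(\<omega> in GW lam. R \<omega>)"
  define q where "q = \<P>(\<omega> in GW lam. root_won 2 \<omega> \<and> B \<omega>)"
  have lost: "root_lost 2 \<omega> \<longleftrightarrow> (\<forall>i<\<omega> []. root_won 2 (subtree [i] \<omega>) \<and> B (subtree [i] \<omega>))"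
    and won: "root_won 2 \<omega> \<longleftrightarrow> (\<exists>i<\<omega> []. root_lost 2 (subtree [i] \<omega>) \<or> R (subtree [i] \<omega>))" for \<omega>
    unfolding B_def R_def by (rule root_lost_2_iff root_won_2_iff)+
  have R_won: "R \<omega> \<Longrightarrow> root_won 2 \<omega>" and R_not_lost: "R \<omega> \<Longrightarrow> \<not> root_lost 2 \<omega>" for \<omega>
    using won[of \<omega>] not_won_and_lost[of "jump 2 \<omega>" "[]"] by (auto simp: R_def)
  have won_B: "root_won 2 \<omega> \<and> B \<omega> \<longleftrightarrow>
      B \<omega> \<and> \<not> (\<forall>i<\<omega> []. root_won 2 (subtree [i] \<omega>) \<and> \<not> R (subtree [i] \<omega>))" for \<omega>
    using won[of \<omega>] not_won_and_lost[of "jump 2 (subtree [_] \<omega>)" "[]"] by (auto simp: B_def)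
  have nl: "nl 2 lam = exp (- lam * (1 - q))"
    unfolding nl_eq q_def lost
    by (rule prob_all_children[OF lam]) measurable
  have r: "r = 1 - exp (- lam * nl 2 lam)"
    unfolding r_def R_def nl_eq by (rule prob_some_child[OF lam]) measurable
  have "nw 2 lam = 1 - exp (- lam * \<P>(\<omega> in GW lam. root_lost 2 \<omega> \<or> R \<omega>))"
    unfolding nw_eq won by (rule prob_some_child[OF lam]) measurable
  also have "\<P>(\<omega> in GW lam. root_lost 2 \<omega> \<or> R \<omega>) = nl 2 lam + r"
    unfolding nl_eq r_def by (rule prob_disjoint_disj) (use R_not_lost in auto)
  finally have nw: "nw 2 lam = 1 - exp (- lam * (nl 2 lam + r))" .
  have "q = \<P>(\<omega> in GW lam. B \<omega> \<and> \<not> (\<forall>i<\<omega> []. root_won 2 (subtree [i] \<omega>) \<and> \<not> R (subtree [i] \<omega>)))"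
    unfolding q_def won_B ..
  also have "\<dots> = \<P>(\<omega> in GW lam. B \<omega>)
      - \<P>(\<omega> in GW lam. \<forall>i<\<omega> []. root_won 2 (subtree [i] \<omega>) \<and> \<not> R (subtree [i] \<omega>))"
    by (rule prob_imp_diff) (measurable, auto simp: B_def)
  also have "\<P>(\<omega> in GW lam. B \<omega>) = exp (- lam * (1 - nw 2 lam))"
    unfolding B_def nw_eq by (rule prob_all_children[OF lam]) measurable
  also have "\<P>(\<omega> in GW lam. \<forall>i<\<omega> []. root_won 2 (subtree [i] \<omega>) \<and> \<not> R (subtree [i] \<omega>)) =
      exp (- lam * (1 - \<P>(\<omega> in GW lam. root_won 2 \<omega> \<and> \<not> R \<omega>)))"
    by (rule prob_all_children[OF lam]) measurable
  also have "\<P>(\<omega> in GW lam. root_won 2 \<omega> \<and> \<not> R \<omega>) = nw 2 lam - r"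
    unfolding nw_eq r_def by (rule prob_imp_diff) (use R_won in auto)
  finally have q: "q = exp (- lam * (1 - nw 2 lam)) - exp (- lam * (1 - nw 2 lam + r))"
    by (simp add: algebra_simps)
  have "0 \<le> q" by (simp add: q_def)
  moreover have "q \<le> nw 2 lam"
    unfolding q_def nw_eq by (rule GW.finite_measure_mono) auto
  ultimately show ?thesis by (rule that[OF nl nw r q])
qed

theorem theorem1p9:
  shows "\<forall>\<^sub>F lam in at_top. nl 2 lam \<le> nl 1 lam \<and> nd 2 lam < nd 1 lam \<and> nw 1 lam < nw 2 lam"
proof -
  have "eventually (\<lambda>lam::real. 0 < lam) at_top" by (rule eventually_gt_at_top)
  moreover have "eventually (\<lambda>lam::real. lam * (1 + lam) * exp (- (3/4) * lam) \<le> 1/4) at_top"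
    by real_asymp
  moreover have "eventually (\<lambda>lam::real. exp (lam * (lam * exp (- (3/4) * lam))) \<le> 2) at_top"
    by real_asymp
  moreover have "eventually (\<lambda>lam::real.
      2 * (lam + 1) * exp (- lam) < 1 - exp (- lam * (1 - exp (- lam * exp (- lam))))) at_top"
    by real_asymp
  moreover have "eventually (\<lambda>lam::real.
      exp (- (3/4) * lam) * (lam * (lam * exp (- (3/4) * lam))) \<le> 1 - exp (- lam * exp (- lam))) at_top"
    by real_asymp
  ultimately show ?thesis
  proof eventually_elim
    case (elim lam)
    note lam = elim(1)
    define a where "a = exp (- (3/4) * lam)"
    have nl_nonneg: "0 \<le> nl k lam" for k by (simp add: nl_eq)
    have nw_nonneg: "0 \<le> nw k lam" for k by (simp add: nw_eq)
    have exp_le: "exp (- lam * (1 - x)) \<le> a" if "x \<le> 1/4" for x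
      using mult_left_mono[OF that, of lam] lam by (simp add: a_def algebra_simps)
    have w1: "nw 1 lam \<le> 1/4" and w2: "nw 2 lam \<le> 1/4"
      by (rule nw_le_quarter[OF _ lam elim(2)]; simp)+
    have exp_lower: "exp (- lam) \<le> exp (- lam * (1 - x))" if "0 \<le> x" for x
      using that lam by (simp add: algebra_simps)

    \<comment> \<open>Since \<open>nl 1 lam\<close> is at most \<open>2 * exp (- lam)\<close>, decided games with \<open>k = 1\<close> have probability of order at most \<open>lam * exp (- lam)\<close>.\<close>
    have l1_le: "nl 1 lam \<le> a" using exp_le[OF w1] nl_1[OF lam] by simp
    have w1_le: "nw 1 lam \<le> lam * nl 1 lam"
      using one_minus_exp_le[of "lam * nl 1 lam"] nw_1[OF lam] by simp
    have "nw 1 lam \<le> lam * a"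
      using order_trans[OF w1_le mult_left_mono[OF l1_le]] lam by simp
    then have "exp (lam * nw 1 lam) \<le> 2"
      using elim(3) lam unfolding a_def[symmetric]
      by (meson exp_le_cancel_iff less_imp_le mult_left_mono order_trans)
    moreover have "nl 1 lam = exp (- lam) * exp (lam * nw 1 lam)"
      using nl_1[OF lam] by (simp add: mult_exp_exp algebra_simps)
    ultimately have l1_upper: "nl 1 lam \<le> 2 * exp (- lam)" by simp
    have "nw 1 lam + nl 1 lam \<le> (lam + 1) * nl 1 lam" using w1_le by (simp add: algebra_simps)
    also have "\<dots> \<le> 2 * (lam + 1) * exp (- lam)"
      using mult_left_mono[OF l1_upper, of "lam + 1"] lam by (simp add: algebra_simps)
    finally have sum1: "nw 1 lam + nl 1 lam \<le> 2 * (lam + 1) * exp (- lam)" .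

    \<comment> \<open>For \<open>k = 2\<close>, a leaf among the grandchildren alone makes \<open>nw 2 lam\<close> of order at least \<open>lam^2 * exp (- lam)\<close>.\<close>
    obtain q r where l2: "nl 2 lam = exp (- lam * (1 - q))"
      and w2_eq: "nw 2 lam = 1 - exp (- lam * (nl 2 lam + r))"
      and r: "r = 1 - exp (- lam * nl 2 lam)"
      and q: "q = exp (- lam * (1 - nw 2 lam)) - exp (- lam * (1 - nw 2 lam + r))"
      and q_nonneg: "0 \<le> q" and q_le: "q \<le> nw 2 lam"
      by (rule two_jump_equations[OF lam])
    have "exp (- lam) \<le> nl 2 lam" using exp_lower[OF q_nonneg] l2 by simp
    then have "1 - exp (- lam * exp (- lam)) \<le> r"
      unfolding r using lam by simp
    then have "1 - exp (- lam * exp (- lam)) \<le> nl 2 lam + r" using nl_nonneg[of 2] by simp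
    then have "1 - exp (- lam * (1 - exp (- lam * exp (- lam)))) \<le> nw 2 lam"
      unfolding w2_eq using lam by simp
    with elim(4) sum1 have sum_less: "nw 1 lam + nl 1 lam < nw 2 lam" by simp

    \<comment> \<open>Comparing the formulas for \<open>nl\<close>, it remains to bound \<open>q\<close>, which is of smaller order than \<open>nw 1 lam\<close>.\<close>
    have "nl 2 lam \<le> a" using exp_le[of q] q_le w2 l2 by simp
    then have "lam * nl 2 lam \<le> lam * a" using lam by simp
    with one_minus_exp_le[of "lam * nl 2 lam"] r have r_le: "r \<le> lam * a" by simp
    have "q = exp (- lam * (1 - nw 2 lam)) * (1 - exp (- (lam * r)))"
      unfolding q by (simp add: algebra_simps mult_exp_exp)
    also have "\<dots> \<le> a * (lam * (lam * a))"
    proof (rule mult_mono)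
      show "1 - exp (- (lam * r)) \<le> lam * (lam * a)"
        using one_minus_exp_le[of "lam * r"] r_le lam by (meson less_imp_le mult_left_mono order_trans)
      show "0 \<le> 1 - exp (- (lam * r))"
        unfolding r using lam nl_nonneg[of 2] by simp
    qed (use exp_le[OF w2] in \<open>auto simp: a_def\<close>)
    also have "\<dots> \<le> 1 - exp (- lam * exp (- lam))" using elim(5) by (simp add: a_def)
    also have "\<dots> \<le> nw 1 lam"
    proof -
      have "exp (- lam) \<le> nl 1 lam" using exp_lower[OF nw_nonneg[of 1]] unfolding nl_1[OF lam] .
      then show ?thesis unfolding nw_1[OF lam] using lam by simp
    qed
    finally have "nl 2 lam \<le> nl 1 lam"
      using l2 nl_1[OF lam] lam by simp
    with sum_less show ?case
      using nl_nonneg[of 1] nl_nonneg[of 2] by (simp add: nd_eq)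
  qed
qed

end
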